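(* There is a relational signature $\sigma$ of arity two for which there is no algorithm $\mathcal A$ with exponential running time and polynomial output size for the following task: given a conjunctive query $Q$ over $\sigma$ of treewidth $\le 2$, produce an alternating two-way tree automaton $A_Q$ on $\Gamma^5_\sigma$-trees that tests $Q$ on $\sigma$-instances of treewidth $\le 5$.
   Context: A relational signature $\sigma$ is a finite set of relation names with arities; its arity is the maximal arity of its relations. A $\sigma$-instance is a finite set of ground facts. A conjunctive query (CQ) is a Boolean, constant-free, existentially quantified conjunction of atoms. The treewidth of a CQ is the treewidth of its canonical instance (variables seen as elements, atoms as facts). A tree decomposition of width $k$ of an instance is a tree of bags, each containing at most $k+1$ elements, such that the elements of each fact lie together in some bag and the bags containing any given element form a connected subtree; treewidth is the minimal width. Tree encodings. For $k\in\mathbb N$ let $\mathcal D_k=\{a_1,\dots,a_{2k+2}\}$, and let $\Gamma^k_\sigma$ be the finite alphabet of pairs $(d,s)$ with $d\subseteq\mathcal D_k$, $|d|\le k+1$, and $s$ either empty or a single $\sigma$-fact over elements of $d$. A $\Gamma^k_\sigma$-encoding is a rooted, ordered, full binary tree $\langle E,\lambda\rangle$ with labels in $\Gamma^k_\sigma$. It decodes, up to isomorphism, to the instance whose elements correspond to the pairs ($a_i$, maximal connected subtree of nodes whose label has $a_i$ in its first component), and whose facts are the facts $s$ of the node labels, with each $a_i$ replaced by the element it represents at that node. Decoded instances have treewidth $\le k$, and every $\sigma$-instance of treewidth $\le k$ has such an encoding. An automaton $A$ on $\Gamma^k_\sigma$-trees tests a query $Q$ for (instances of) treewidth ($\le$)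 $k$ if for every $\Gamma^k_\sigma$-encoding $\langle E,\lambda\rangle$ of an instance $I$, $A$ accepts $\langle E,\lambda\rangle$ iff $I\models Q$. Alternating two-way tree automata (standard notion). On full binary ordered $\Gamma$-trees, such an automaton has a finite state set $\mathcal Q$, an initial state $q_{\mathrm I}$, and a transition function mapping $\mathcal Q\times\Gamma$ to positive Boolean formulas over $\{\mathrm{stay},\mathrm{up},\mathrm{left},\mathrm{right}\}\times\mathcal Q$. It accepts a tree if there is a finite run tree with root labeled ($q_{\mathrm I}$, root), in which for every node labeled $(q,w)$ there is a set of pairs (direction, state) satisfying the formula for $q$ and the label of $w$ such that, for each pair $(\delta,q')$ in the set, the tree node $w'$ reached from $w$ in direction $\delta$ exists and the run node has a child labeled $(q',w')$. *)

theory Defs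
  imports "HOL-Computational_Algebra.Polynomial"
begin

section \<open>Signatures, instances, conjunctive queries\<close>

type_synonym signature = "nat \<rightharpoonup> nat"

definition is_signature :: "signature \<Rightarrow> bool" where
  "is_signature \<sigma> \<longleftrightarrow> finite (dom \<sigma>)"

text \<open>The inserted 0 only serves to give the empty signature arity 0.\<close>

definition signature_arity :: "signature \<Rightarrow> nat" where
  "signature_arity \<sigma> = Max (insert 0 (ran \<sigma>))"

type_synonym 'a fact = "nat \<times> 'a list"
type_synonym 'a inst = "'a fact set"

definition fact_over :: "signature \<Rightarrow> 'a set \<Rightarrow> 'a fact \<Rightarrow> bool" where
  "fact_over \<sigma> X F \<longleftrightarrow> \<sigma> (fst F) = Some (length (snd F)) \<and> set (snd F) \<subseteq> X"

definition adom :: "'a inst \<Rightarrow> 'a set" where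
  "adom I = (\<Union>F\<in>I. set (snd F))"

text \<open>
  A Boolean constant-free conjunctive query is the list of its atoms; all variables
  (natural numbers) are existentially quantified. Its canonical instance is the set
  of its atoms.
\<close>

type_synonym cq = "nat fact list"

definition cq_over :: "signature \<Rightarrow> cq \<Rightarrow> bool" where
  "cq_over \<sigma> Q \<longleftrightarrow> (\<forall>F\<in>set Q. fact_over \<sigma> UNIV F)"

definition models :: "'a inst \<Rightarrow> cq \<Rightarrow> bool" where
  "models I Q \<longleftrightarrow> (\<exists>h. \<forall>(R, xs)\<in>set Q. (R, map h xs) \<in> I)"


section \<open>Trees and treewidth\<close>

text \<open>
  The nodes of a tree are the paths leading to them from the root \<open>[]\<close>; the children
  of \<open>u\<close> are the nodes \<open>u @ [i]\<close>.
\<close>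

definition is_tree :: "'d list set \<Rightarrow> bool" where
  "is_tree T \<longleftrightarrow> finite T \<and> [] \<in> T \<and> (\<forall>u i. u @ [i] \<in> T \<longrightarrow> u \<in> T)"

definition tree_adj :: "'d list \<Rightarrow> 'd list \<Rightarrow> bool" where
  "tree_adj u v \<longleftrightarrow> (\<exists>i. u = v @ [i] \<or> v = u @ [i])"

definition component :: "'d list set \<Rightarrow> 'd list \<Rightarrow> 'd list set" where
  "component S u = {v. (u, v) \<in> {(x, y). x \<in> S \<and> y \<in> S \<and> tree_adj x y}\<^sup>*}"

definition tree_connected :: "'d list set \<Rightarrow> bool" where
  "tree_connected S \<longleftrightarrow> (\<forall>u\<in>S. S \<subseteq> component S u)"

definition tree_decomposition ::
  "nat \<Rightarrow> 'a inst \<Rightarrow> nat list set \<Rightarrow> (nat list \<Rightarrow> 'a set) \<Rightarrow> bool" where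
  "tree_decomposition k I T bag \<longleftrightarrow>
     is_tree T \<and>
     (\<forall>u\<in>T. bag u \<subseteq> adom I \<and> finite (bag u) \<and> card (bag u) \<le> k + 1) \<and>
     (\<forall>F\<in>I. \<exists>u\<in>T. set (snd F) \<subseteq> bag u) \<and>
     (\<forall>a. tree_connected {u \<in> T. a \<in> bag u})"

text \<open>Meaningful for finite instances, where the least element exists.\<close>

definition treewidth :: "'a inst \<Rightarrow> nat" where
  "treewidth I = (LEAST k. \<exists>T bag. tree_decomposition k I T bag)"


section \<open>Tree encodings\<close>

type_synonym label = "nat set \<times> nat fact option"
type_synonym 'l ltree = "bool list set \<times> (bool list \<Rightarrow> 'l)"

text \<open>Left child: \<open>False\<close>; right child: \<open>True\<close>.\<close>

definition full_binary :: "bool list set \<Rightarrow> bool" where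
  "full_binary E \<longleftrightarrow> is_tree E \<and> (\<forall>u\<in>E. u @ [False] \<in> E \<longleftrightarrow> u @ [True] \<in> E)"

definition enc_dom :: "nat \<Rightarrow> nat set" where
  "enc_dom k = {1..2 * k + 2}"

definition enc_alphabet :: "signature \<Rightarrow> nat \<Rightarrow> label set" where
  "enc_alphabet \<sigma> k =
     {(d, s). d \<subseteq> enc_dom k \<and> card d \<le> k + 1 \<and> (\<forall>F. s = Some F \<longrightarrow> fact_over \<sigma> d F)}"

definition is_encoding :: "signature \<Rightarrow> nat \<Rightarrow> label ltree \<Rightarrow> bool" where
  "is_encoding \<sigma> k t \<longleftrightarrow>
     full_binary (fst t) \<and> (\<forall>u\<in>fst t. snd t u \<in> enc_alphabet \<sigma> k)"

definition enc_elem :: "label ltree \<Rightarrow> bool list \<Rightarrow> nat \<Rightarrow> nat \<times> bool list set" where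
  "enc_elem t u a = (a, component {v \<in> fst t. a \<in> fst (snd t v)} u)"

definition decode :: "label ltree \<Rightarrow> (nat \<times> bool list set) inst" where
  "decode t = {(R, map (enc_elem t u) as) | u R as. u \<in> fst t \<and> snd (snd t u) = Some (R, as)}"


section \<open>Alternating two-way tree automata\<close>

datatype 'p pbf = PTrue | PFalse | PVar 'p | PAnd "'p pbf" "'p pbf" | POr "'p pbf" "'p pbf"

primrec pbf_sat :: "'p set \<Rightarrow> 'p pbf \<Rightarrow> bool" where
  "pbf_sat S PTrue \<longleftrightarrow> True"
| "pbf_sat S PFalse \<longleftrightarrow> False"
| "pbf_sat S (PVar p) \<longleftrightarrow> p \<in> S"
| "pbf_sat S (PAnd f g) \<longleftrightarrow> pbf_sat S f \<and> pbf_sat S g"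
| "pbf_sat S (POr f g) \<longleftrightarrow> pbf_sat S f \<or> pbf_sat S g"

datatype dir = Stay | Up | GoLeft | GoRight

record 'l automaton =
  states :: "nat set"
  init :: nat
  delta :: "nat \<Rightarrow> 'l \<Rightarrow> (dir \<times> nat) pbf"

definition is_automaton :: "'l set \<Rightarrow> 'l automaton \<Rightarrow> bool" where
  "is_automaton \<Gamma> A \<longleftrightarrow>
     finite (states A) \<and> init A \<in> states A \<and>
     (\<forall>q\<in>states A. \<forall>l\<in>\<Gamma>. set_pbf (delta A q l) \<subseteq> UNIV \<times> states A)"

text \<open>\<open>go E w D w'\<close>: the node of \<open>E\<close> reached from \<open>w\<close> in direction \<open>D\<close> exists and is \<open>w'\<close>.\<close>

fun go :: "bool list set \<Rightarrow> bool list \<Rightarrow> dir \<Rightarrow> bool list \<Rightarrow> bool" where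
  "go E w Stay w' \<longleftrightarrow> w' \<in> E \<and> w' = w"
| "go E w Up w' \<longleftrightarrow> w' \<in> E \<and> (\<exists>i. w = w' @ [i])"
| "go E w GoLeft w' \<longleftrightarrow> w' \<in> E \<and> w' = w @ [False]"
| "go E w GoRight w' \<longleftrightarrow> w' \<in> E \<and> w' = w @ [True]"

datatype run = Run (run_label: "nat \<times> bool list") (run_children: "run list")

fun is_run :: "'l automaton \<Rightarrow> 'l ltree \<Rightarrow> run \<Rightarrow> bool" where
  "is_run A t (Run (q, w) rs) \<longleftrightarrow>
     q \<in> states A \<and> w \<in> fst t \<and>
     (\<exists>S. pbf_sat S (delta A q (snd t w)) \<and>
       (\<forall>(D, q')\<in>S. \<exists>w'. go (fst t) w D w' \<and> (\<exists>r\<in>set rs. run_label r = (q', w')))) \<and>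
     (\<forall>r\<in>set rs. is_run A t r)"

definition accepts :: "'l automaton \<Rightarrow> 'l ltree \<Rightarrow> bool" where
  "accepts A t \<longleftrightarrow> (\<exists>r. run_label r = (init A, []) \<and> is_run A t r)"

definition tests_query :: "signature \<Rightarrow> nat \<Rightarrow> label automaton \<Rightarrow> cq \<Rightarrow> bool" where
  "tests_query \<sigma> k A Q \<longleftrightarrow>
     (\<forall>t. is_encoding \<sigma> k t \<longrightarrow> (accepts A t \<longleftrightarrow> models (decode t) Q))"


section \<open>Representation of queries and automata as words\<close>

datatype sexp = Num nat | Lst "sexp list"

text \<open>
  Words are over the symbols 1 to 5: 1 and 2 are the binary digits zero and one
  (numbers have their least significant digit first), 3 ends a number, 4 and 5 are
  opening and closing brackets. The code is prefix-free (\<open>ser_prefix_free\<close>), hence injective.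
\<close>

fun bits :: "nat \<Rightarrow> nat list" where
  "bits n = (if n = 0 then [] else (1 + n mod 2) # bits (n div 2))"

declare bits.simps [simp del]

fun ser :: "sexp \<Rightarrow> nat list" where
  "ser (Num n) = bits n @ [3]"
| "ser (Lst es) = [4] @ concat (map ser es) @ [5]"

lemma bits_range: "x \<in> set (bits n) \<Longrightarrow> x = 1 \<or> x = 2"
proof (induction n rule: bits.induct)
  case (1 n) then show ?case by (subst (asm) (2) bits.simps) (auto split: if_splits)
qed

lemma bits_inj: "bits m @ 3 # u = bits n @ 3 # v \<Longrightarrow> m = n \<and> u = v"
proof (induction m arbitrary: n rule: less_induct)
  case (less m)
  show ?case
  proof (cases "m = 0 \<or> n = 0")
    case True then show ?thesis using less.prems bits.simps[of m] bits.simps[of n]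
      by (auto split: if_splits)
  next
    case False
    then have "m mod 2 = n mod 2" "bits (m div 2) @ 3 # u = bits (n div 2) @ 3 # v"
      using less.prems bits.simps[of m] bits.simps[of n] by auto
    moreover have "m div 2 < m" using False by simp
    ultimately show ?thesis using less.IH[of "m div 2" "n div 2"]
      by (metis mod_mult_div_eq)
  qed
qed

lemma ser_hd: "\<exists>x xs. ser e = x # xs \<and> x < 5"
proof (cases e)
  case (Num n)
  show ?thesis
  proof (cases "bits n")
    case Nil then show ?thesis using Num by simp
  next
    case (Cons x xs)
    then have "x = 1 \<or> x = 2" using bits_range[of x n] by simp
    then show ?thesis using Num Cons by auto
  qed
qed simp

lemma sers_prefix_free:
  assumes "\<And>e f u v. e \<in> set es \<Longrightarrow> ser e @ u = ser f @ v \<Longrightarrow> e = f \<and> u = v"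
    and "concat (map ser es) @ 5 # u = concat (map ser fs) @ 5 # v"
  shows "es = fs \<and> u = v"
  using assms
proof (induction es arbitrary: fs)
  case Nil
  show ?case
  proof (cases fs)
    case Nil
    with Nil.prems(2) show ?thesis by simp
  next
    case (Cons g gs)
    obtain x xs where "ser g = x # xs" "x < 5" using ser_hd[of g] by blast
    with Nil.prems(2) Cons show ?thesis by simp
  qed
next
  case (Cons e es fs)
  show ?case
  proof (cases fs)
    case Nil
    obtain x xs where "ser e = x # xs" "x < 5" using ser_hd[of e] by blast
    with Cons.prems(2) Nil show ?thesis by simp
  next
    case fs: (Cons g gs)
    have "ser e @ (concat (map ser es) @ 5 # u) = ser g @ (concat (map ser gs) @ 5 # v)"
      using Cons.prems(2) by (simp add: fs)
    then have *: "e = g \<and> concat (map ser es) @ 5 # u = concat (map ser gs) @ 5 # v"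
      by (rule Cons.prems(1)[rotated]) simp
    have "es = gs \<and> u = v"
    proof (rule Cons.IH)
      show "e' = f' \<and> u' = v'" if "e' \<in> set es" "ser e' @ u' = ser f' @ v'" for e' f' u' v'
        by (rule Cons.prems(1)[OF _ that(2)]) (simp add: that(1))
      show "concat (map ser es) @ 5 # u = concat (map ser gs) @ 5 # v"
        using * by blast
    qed
    with * fs show ?thesis by blast
  qed
qed

lemma ser_Num_neq_Lst: "ser (Num n) @ u \<noteq> ser (Lst es) @ v"
proof (cases "bits n")
  case (Cons x xs)
  then have "x = 1 \<or> x = 2" using bits_range[of x n] by simp
  with Cons show ?thesis by auto
qed simp

lemma ser_prefix_free: "ser e @ u = ser f @ v \<Longrightarrow> e = f \<and> u = v"
proof (induction e arbitrary: f u v)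
  case (Num n)
  then obtain m where "f = Num m" using ser_Num_neq_Lst by (cases f) metis+
  with Num bits_inj[of n u m v] show ?case by simp
next
  case (Lst es)
  obtain fs where f: "f = Lst fs" using Lst.prems ser_Num_neq_Lst by (cases f) metis+
  have "es = fs \<and> u = v"
  proof (rule sers_prefix_free)
    show "e' = f' \<and> u' = v'" if "e' \<in> set es" "ser e' @ u' = ser f' @ v'" for e' f' u' v'
      using that by (rule Lst.IH)
    show "concat (map ser es) @ 5 # u = concat (map ser fs) @ 5 # v"
      using Lst.prems by (simp add: f)
  qed
  with f show ?case by blast
qed

definition fact_sexp :: "nat fact \<Rightarrow> sexp" where
  "fact_sexp F = Lst (Num (fst F) # map Num (snd F))"

definition cq_code :: "cq \<Rightarrow> nat list" where
  "cq_code Q = ser (Lst (map fact_sexp Q))"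

definition label_sexp :: "label \<Rightarrow> sexp" where
  "label_sexp l =
     Lst [Lst (map Num (sorted_list_of_set (fst l))),
          (case snd l of None \<Rightarrow> Lst [] | Some F \<Rightarrow> fact_sexp F)]"

primrec dir_num :: "dir \<Rightarrow> nat" where
  "dir_num Stay = 0"
| "dir_num Up = 1"
| "dir_num GoLeft = 2"
| "dir_num GoRight = 3"

primrec pbf_sexp :: "(dir \<times> nat) pbf \<Rightarrow> sexp" where
  "pbf_sexp PTrue = Lst [Num 0]"
| "pbf_sexp PFalse = Lst [Num 1]"
| "pbf_sexp (PVar p) = Lst [Num 2, Num (dir_num (fst p)), Num (snd p)]"
| "pbf_sexp (PAnd f g) = Lst [Num 3, pbf_sexp f, pbf_sexp g]"
| "pbf_sexp (POr f g) = Lst [Num 4, pbf_sexp f, pbf_sexp g]"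

text \<open>
  A word represents an automaton if it lists its states, its initial state and its
  full transition table, the states and labels being enumerated in any order.
\<close>

definition is_automaton_code :: "label set \<Rightarrow> label automaton \<Rightarrow> nat list \<Rightarrow> bool" where
  "is_automaton_code \<Gamma> A v \<longleftrightarrow>
     (\<exists>qs ls. distinct qs \<and> set qs = states A \<and> distinct ls \<and> set ls = \<Gamma> \<and>
        v = ser (Lst [Lst (map Num qs), Num (init A),
              Lst [Lst [Num q, label_sexp l, pbf_sexp (delta A q l)]. q \<leftarrow> qs, l \<leftarrow> ls]]))"


section \<open>Algorithms\<close>

text \<open>
  Deterministic Turing machines with one two-way infinite tape. The states are the
  numbers below \<open>tm_states\<close>, with start state 0; the tape symbols are the numbers
  below \<open>tm_symbols\<close>, with blank 0. The machine halts when no transition is defined.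
\<close>

datatype move = MoveL | MoveN | MoveR

primrec shift :: "move \<Rightarrow> int" where
  "shift MoveL = - 1"
| "shift MoveN = 0"
| "shift MoveR = 1"

record tm =
  tm_states :: nat
  tm_symbols :: nat
  tm_trans :: "nat \<Rightarrow> nat \<Rightarrow> (nat \<times> nat \<times> move) option"

definition is_tm :: "tm \<Rightarrow> bool" where
  "is_tm M \<longleftrightarrow>
     0 < tm_states M \<and> 5 < tm_symbols M \<and>
     (\<forall>q<tm_states M. \<forall>a<tm_symbols M. \<forall>q' b m.
        tm_trans M q a = Some (q', b, m) \<longrightarrow> q' < tm_states M \<and> b < tm_symbols M)"

type_synonym config = "nat \<times> int \<times> (int \<Rightarrow> nat)"

fun tm_halted :: "tm \<Rightarrow> config \<Rightarrow> bool" where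
  "tm_halted M (q, p, tp) \<longleftrightarrow> tm_trans M q (tp p) = None"

fun tm_step :: "tm \<Rightarrow> config \<Rightarrow> config" where
  "tm_step M (q, p, tp) =
     (case tm_trans M q (tp p) of
        None \<Rightarrow> (q, p, tp)
      | Some (q', b, m) \<Rightarrow> (q', p + shift m, tp(p := b)))"

definition word_tape :: "nat list \<Rightarrow> int \<Rightarrow> nat" where
  "word_tape w i = (if 0 \<le> i \<and> nat i < length w then w ! nat i else 0)"

definition tm_start :: "nat list \<Rightarrow> config" where
  "tm_start w = (0, 0, word_tape w)"

text \<open>The output is the word from cell 0 up to the next blank.\<close>

definition tape_output :: "(int \<Rightarrow> nat) \<Rightarrow> nat list \<Rightarrow> bool" where
  "tape_output tp v \<longleftrightarrow>
     (\<forall>i<length v. tp (int i) = v ! i \<and> v ! i \<noteq> 0) \<and> tp (int (length v)) = 0"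

text \<open>On input \<open>w\<close>, \<open>M\<close> halts after at most \<open>n\<close> steps with output \<open>v\<close>.\<close>

definition tm_computes :: "tm \<Rightarrow> nat list \<Rightarrow> nat \<Rightarrow> nat list \<Rightarrow> bool" where
  "tm_computes M w n v \<longleftrightarrow>
     (\<exists>q p tp. (tm_step M ^^ n) (tm_start w) = (q, p, tp) \<and>
        tm_halted M (q, p, tp) \<and> tape_output tp v)"

end

theory Submission
  imports Defs
begin

text \<open>
  The obstruction is the size of the automaton, not the time needed to compute it. For a set
  \<open>X\<close> of \<open>n\<close>-bit addresses, take a tree whose left half marks the addresses in \<open>X\<close> and whose
  right half marks those in \<open>Y\<close>. A ladder-shaped query of treewidth 2 and size polynomial in \<open>n\<close>
  compares two addresses bit by bit, thus expressing that \<open>X\<close> meets \<open>Y\<close>. The trees for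
  \<open>(X, - X)\<close> form a fooling set of size \<open>2 ^ (2 ^ n)\<close>: if an automaton rejects the trees for
  \<open>(X, - X)\<close> and \<open>(Y, - Y)\<close> and the sets of states accepting at the two nodes along the cut agree,
  then it also rejects the tree for \<open>(X, - Y)\<close>, so \<open>X \<subseteq> Y\<close>. Hence the automaton has at least
  \<open>2 ^ n div 2\<close> states, which no output of polynomial length can list.
\<close>

section \<open>Rejection is preserved under hybrids\<close>

text \<open>A run started at \<open>w\<close> may leave the subtree below \<open>w\<close>, so the
  set of states accepting at a node depends on the whole tree.\<close>

definition accepts_from :: "'l automaton \<Rightarrow> 'l ltree \<Rightarrow> nat \<Rightarrow> bool list \<Rightarrow> bool" where
  "accepts_from A t q w \<longleftrightarrow> (\<exists>r. run_label r = (q, w) \<and> is_run A t r)"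

lemma pbf_sat_mono: "pbf_sat S f \<Longrightarrow> S \<inter> set_pbf f \<subseteq> S' \<Longrightarrow> pbf_sat S' f"
  by (induction f) auto

lemma finite_set_pbf: "finite (set_pbf f)"
  by (induction f) auto

lemma accepts_from_step:
  assumes "q \<in> states A" "w \<in> fst t" "pbf_sat S (delta A q (snd t w))"
    and "\<And>D q'. (D, q') \<in> S \<Longrightarrow> \<exists>w'. go (fst t) w D w' \<and> accepts_from A t q' w'"
  shows "accepts_from A t q w"
proof -
  \<comment> \<open>A run node has finitely many children, whereas \<open>S\<close> may be infinite.
    Only the finitely many pairs that occur in the formula are kept.\<close>
  define S' where "S' = S \<inter> set_pbf (delta A q (snd t w))"
  have fin: "finite S'" by (simp add: S'_def finite_set_pbf)
  have sat: "pbf_sat S' (delta A q (snd t w))"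
    using assms(3) by (rule pbf_sat_mono) (simp add: S'_def)
  have "\<forall>p\<in>S'. \<exists>r. \<exists>w'. go (fst t) w (fst p) w' \<and> run_label r = (snd p, w') \<and> is_run A t r"
    using assms(4) by (fastforce simp: S'_def accepts_from_def)
  then obtain f where f: "\<forall>p\<in>S'. \<exists>w'. go (fst t) w (fst p) w' \<and>
      run_label (f p) = (snd p, w') \<and> is_run A t (f p)"
    by metis
  obtain ps where ps: "set ps = S'" using finite_list[OF fin] by blast
  have "is_run A t (Run (q, w) (map f ps))"
    unfolding is_run.simps
  proof (intro conjI exI[of _ S'])
    show "\<forall>(D, q')\<in>S'. \<exists>w'. go (fst t) w D w' \<and>
        (\<exists>r\<in>set (map f ps). run_label r = (q', w'))"
      using f ps by fastforce
    show "\<forall>r\<in>set (map f ps). is_run A t r" using f ps by auto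
  qed (use assms sat in auto)
  then show ?thesis unfolding accepts_from_def by (intro exI[of _ "Run (q, w) (map f ps)"]) simp
qed

text \<open>Run trees are finite, so acceptance is the least predicate closed under the run
  rule.\<close>

lemma accepts_from_induct:
  assumes "accepts_from A t q w"
    and closed: "\<And>q w S. q \<in> states A \<Longrightarrow> w \<in> fst t \<Longrightarrow> pbf_sat S (delta A q (snd t w)) \<Longrightarrow>
      (\<And>D q'. (D, q') \<in> S \<Longrightarrow> \<exists>w'. go (fst t) w D w' \<and> F q' w') \<Longrightarrow> F q w"
  shows "F q w"
proof -
  have "is_run A t r \<Longrightarrow> F (fst (run_label r)) (snd (run_label r))" for r
  proof (induction r)
    case (Run x rs)
    obtain q w where x: "x = (q, w)" by (cases x)
    from Run.prems obtain S where S: "q \<in> states A" "w \<in> fst t" "pbf_sat S (delta A q (snd t w))"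
      "\<forall>(D, q')\<in>S. \<exists>w'. go (fst t) w D w' \<and> (\<exists>r\<in>set rs. run_label r = (q', w'))"
      "\<forall>r\<in>set rs. is_run A t r"
      unfolding x is_run.simps by blast
    have "F q w"
    proof (rule closed[OF S(1-3)])
      fix D q' assume "(D, q') \<in> S"
      then obtain w' r where "go (fst t) w D w'" "r \<in> set rs" "run_label r = (q', w')"
        using S(4) by blast
      then show "\<exists>w'. go (fst t) w D w' \<and> F q' w'" using Run.IH[of r] S(5) by auto
    qed
    then show ?case by (simp add: x)
  qed
  then show ?thesis using assms(1) unfolding accepts_from_def by force
qed

lemma go_tree_adj: "go E w D w' \<Longrightarrow> w' = w \<or> tree_adj w w'"
  by (cases D) (auto simp: tree_adj_def)

text \<open>
  The sets of states accepting at the nodes of the two trees glue to a set that is closed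
  under the run rule for the hybrid tree, hence contains everything accepted there.
\<close>

lemma accepts_from_hybrid:
  assumes acc: "accepts_from A (E, \<lambda>w. if w \<in> P then l1 w else l2 w) q w"
    and agree: "\<And>w w' q. q \<in> states A \<Longrightarrow> w \<in> P \<Longrightarrow> w' \<notin> P \<Longrightarrow> tree_adj w w' \<Longrightarrow>
      (accepts_from A (E, l1) q w \<longleftrightarrow> accepts_from A (E, l2) q w) \<and>
      (accepts_from A (E, l1) q w' \<longleftrightarrow> accepts_from A (E, l2) q w')"
  shows "if w \<in> P then accepts_from A (E, l1) q w else accepts_from A (E, l2) q w"
proof -
  have sym: "tree_adj v w \<Longrightarrow> tree_adj w v" for v w :: "bool list"
    by (auto simp: tree_adj_def)
  \<comment> \<open>Every state in a run belongs to \<open>A\<close>, and \<open>agree\<close>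
    speaks of such states only.\<close>
  have st: "accepts_from A t q w \<Longrightarrow> q \<in> states A" for t :: "'a ltree" and q w
    unfolding accepts_from_def by (metis is_run.simps prod.collapse run.collapse run.sel(1))
  show ?thesis
    using acc
  proof (rule accepts_from_induct)
    fix q w S
    assume *: "q \<in> states A" "w \<in> fst (E, \<lambda>w. if w \<in> P then l1 w else l2 w)"
      "pbf_sat S (delta A q (snd (E, \<lambda>w. if w \<in> P then l1 w else l2 w) w))"
      "\<And>D q'. (D, q') \<in> S \<Longrightarrow> \<exists>w'. go (fst (E, \<lambda>w. if w \<in> P then l1 w else l2 w)) w D w' \<and>
        (if w' \<in> P then accepts_from A (E, l1) q' w' else accepts_from A (E, l2) q' w')"
    show "if w \<in> P then accepts_from A (E, l1) q w else accepts_from A (E, l2) q w"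
    proof (cases "w \<in> P")
      case True
      have "accepts_from A (E, l1) q w"
      proof (rule accepts_from_step[of q A w "(E, l1)" S])
        fix D q' assume "(D, q') \<in> S"
        with *(4) obtain w' where w': "go E w D w'"
          "if w' \<in> P then accepts_from A (E, l1) q' w' else accepts_from A (E, l2) q' w'"
          by fastforce
        have "accepts_from A (E, l1) q' w'"
        proof (cases "w' \<in> P")
          case False
          \<comment> \<open>The move crosses the border of \<open>P\<close>, where
            \<open>agree\<close> carries acceptance from one tree to the other.\<close>
          then have "tree_adj w w'" using go_tree_adj[OF w'(1)] True by auto
          moreover have "accepts_from A (E, l2) q' w'" using w'(2) False by simp
          ultimately show ?thesis using agree[OF st True False] by blast
        qed (use w' in simp)
        with w'(1) show "\<exists>w'. go (fst (E, l1)) w D w' \<and> accepts_from A (E, l1) q' w'" by auto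
      qed (use * True in auto)
      then show ?thesis using True by simp
    next
      case False
      have "accepts_from A (E, l2) q w"
      proof (rule accepts_from_step[of q A w "(E, l2)" S])
        fix D q' assume "(D, q') \<in> S"
        with *(4) obtain w' where w': "go E w D w'"
          "if w' \<in> P then accepts_from A (E, l1) q' w' else accepts_from A (E, l2) q' w'"
          by fastforce
        have "accepts_from A (E, l2) q' w'"
        proof (cases "w' \<in> P")
          case True
          then have "tree_adj w' w" using go_tree_adj[OF w'(1)] False sym by auto
          moreover have "accepts_from A (E, l1) q' w'" using w'(2) True by simp
          ultimately show ?thesis using agree[OF st True False] by blast
        qed (use w' in simp)
        with w'(1) show "\<exists>w'. go (fst (E, l2)) w D w' \<and> accepts_from A (E, l2) q' w'" by auto
      qed (use * False in auto)
      then show ?thesis using False by simp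
    qed
  qed
qed


section \<open>The queries\<close>

text \<open>Relations 0 and 1 mark elements according to the left and the right set, 2 leads from an
  element to the one introduced two levels higher, and 3 links an element to the constant for its
  bit.\<close>

definition sig :: signature where
  "sig = [0 \<mapsto> 1, 1 \<mapsto> 1, 2 \<mapsto> 2, 3 \<mapsto> 2]"

text \<open>
  The variables \<open>x\<^sub>i = 3 i\<close> and \<open>y\<^sub>i = 3 i + 1\<close> form the rails of a ladder whose
  \<open>i\<close>-th rung is subdivided by \<open>z\<^sub>i = 3 i + 2\<close>.
\<close>

definition rung :: "nat \<Rightarrow> cq" where
  "rung i = [(3, [3 * i, 3 * i + 2]), (3, [3 * i + 1, 3 * i + 2]),
     (2, [3 * i, 3 * i + 3]), (2, [3 * i + 1, 3 * i + 4])]"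

text \<open>Both rails start at a marked element and climb \<open>n\<close> steps. Sharing
  \<open>z\<close> on a rung forces equal bits. The ends of the rails have no rung: they will carry
  the first letters of the two leaves, which differ.\<close>

definition ladder :: "nat \<Rightarrow> cq" where
  "ladder n = (0, [0]) # (1, [1]) # concat (map rung [0..<n])"

lemma sig_signature: "is_signature sig"
  by (simp add: is_signature_def sig_def)

lemma sig_arity: "signature_arity sig = 2"
proof -
  have "ran sig = {1, 2}" by (simp add: sig_def insert_commute)
  then show ?thesis by (simp add: signature_arity_def)
qed

lemma ladder_cq_over: "cq_over sig (ladder n)"
  by (auto simp: cq_over_def ladder_def rung_def fact_over_def sig_def)

lemma models_ladder_iff:
  "models I (ladder n) \<longleftrightarrow> (\<exists>x y z. (0, [x 0]) \<in> I \<and> (1, [y 0]) \<in> I \<and>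
     (\<forall>i<n. (3, [x i, z i]) \<in> I \<and> (3, [y i, z i]) \<in> I \<and>
        (2, [x i, x (Suc i)]) \<in> I \<and> (2, [y i, y (Suc i)]) \<in> I))"
  (is "_ \<longleftrightarrow> ?R")
proof
  assume "models I (ladder n)"
  then obtain h where h: "\<forall>(R, xs)\<in>set (ladder n). (R, map h xs) \<in> I"
    by (auto simp: models_def)
  show ?R
    by (rule exI[of _ "\<lambda>i. h (3 * i)"], rule exI[of _ "\<lambda>i. h (3 * i + 1)"],
        rule exI[of _ "\<lambda>i. h (3 * i + 2)"])
       (use h in \<open>auto simp: ladder_def rung_def add_ac\<close>)
next
  assume ?R
  then obtain x y z where xyz: "(0, [x 0]) \<in> I" "(1, [y 0]) \<in> I"
     "\<And>i. i < n \<Longrightarrow> (3, [x i, z i]) \<in> I \<and> (3, [y i, z i]) \<in> I \<and>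
        (2, [x i, x (Suc i)]) \<in> I \<and> (2, [y i, y (Suc i)]) \<in> I"
    by blast
  define h where "h v = (if v mod 3 = 0 then x (v div 3) else if v mod 3 = 1 then y (v div 3)
    else z (v div 3))" for v :: nat
  have hx: "h (3 * i) = x i" for i by (simp add: h_def)
  have hy: "h (Suc (3 * i)) = y i" for i
  proof -
    have "Suc (3 * i) mod 3 = 1" "Suc (3 * i) div 3 = i" by presburger+
    then show ?thesis by (simp add: h_def)
  qed
  have hz: "h (Suc (Suc (3 * i))) = z i" for i
  proof -
    have "Suc (Suc (3 * i)) mod 3 = 2" "Suc (Suc (3 * i)) div 3 = i" by presburger+
    then show ?thesis by (simp add: h_def)
  qed
  have hx': "h (3 * i + 3) = x (Suc i)" for i using hx[of "Suc i"] by (simp add: add_ac)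
  have hy': "h (3 * i + 4) = y (Suc i)" for i using hy[of "Suc i"] by (simp add: add_ac)
  have "\<forall>(R, xs)\<in>set (ladder n). (R, map h xs) \<in> I"
    using xyz hx[of 0] hy[of 0]
    by (auto simp: ladder_def rung_def hx hy hz hx' hy')
  then show "models I (ladder n)" unfolding models_def by blast
qed

section \<open>Treewidth of the ladder\<close>

lemma tree_connected_interval:
  "tree_connected {u. \<exists>j. a \<le> j \<and> j < b \<and> u = replicate j (0::nat)}"
  (is "tree_connected ?S")
proof -
  let ?r = "{(x, y). x \<in> ?S \<and> y \<in> ?S \<and> tree_adj x y}"
  have up: "(replicate i 0, replicate (i + k) 0) \<in> ?r\<^sup>*" if "a \<le> i" "i + k < b" for i k
    using that
  proof (induction k)
    case (Suc k)
    have "replicate (i + Suc k) 0 = replicate (i + k) 0 @ [0]"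
      by (simp add: replicate_append_same)
    moreover have "replicate (i + Suc k) 0 \<in> ?S"
      using Suc.prems by (simp del: replicate_Suc add_Suc_right)
    moreover have "replicate (i + k) 0 \<in> ?S"
      using Suc.prems by (auto simp del: replicate_Suc)
    ultimately have "(replicate (i + k) 0, replicate (i + Suc k) 0) \<in> ?r"
      unfolding tree_adj_def by blast
    moreover have "(replicate i 0, replicate (i + k) 0) \<in> ?r\<^sup>*"
      using Suc by simp
    ultimately show ?case by (rule rtrancl_into_rtrancl[rotated])
  qed simp
  have "sym ?r" by (auto simp: sym_def tree_adj_def)
  then have sym: "sym (?r\<^sup>*)" by (rule sym_rtrancl)
  have "(replicate i 0, replicate j 0) \<in> ?r\<^sup>*" if "a \<le> i" "i < b" "a \<le> j" "j < b" for i j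
  proof (cases "i \<le> j")
    case True
    then show ?thesis using up[of i "j - i"] that by simp
  next
    case False
    then have "(replicate j 0, replicate i 0) \<in> ?r\<^sup>*" using up[of j "i - j"] that by simp
    with sym show ?thesis by (rule symD)
  qed
  then show ?thesis by (auto simp: tree_connected_def component_def)
qed

text \<open>The bags of a path decomposition, three elements each. From one bag to the next a single
  variable is exchanged: \<open>z\<^sub>i\<close> for the next \<open>x\<close>, then
  \<open>x\<^sub>i\<close> for the next \<open>y\<close>, then \<open>y\<^sub>i\<close> for the next
  \<open>z\<close>.\<close>

definition ladder_bag :: "nat \<Rightarrow> nat set" where
  "ladder_bag j = (let i = j div 3 in
     if j mod 3 = 0 then {3 * i, 3 * i + 1, 3 * i + 2}
     else if j mod 3 = 1 then {3 * i, 3 * i + 1, 3 * i + 3}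
     else {3 * i + 1, 3 * i + 3, 3 * i + 4})"

lemma ladder_bag_simps:
  "ladder_bag (3 * i) = {3 * i, 3 * i + 1, 3 * i + 2}"
  "ladder_bag (3 * i + 1) = {3 * i, 3 * i + 1, 3 * i + 3}"
  "ladder_bag (3 * i + 2) = {3 * i + 1, 3 * i + 3, 3 * i + 4}"
proof -
  have "(3 * i + 1) mod 3 = 1" "(3 * i + 1) div 3 = i" "(3 * i + 2) mod 3 = 2"
    "(3 * i + 2) div 3 = i" by presburger+
  then show "ladder_bag (3 * i) = {3 * i, 3 * i + 1, 3 * i + 2}"
    "ladder_bag (3 * i + 1) = {3 * i, 3 * i + 1, 3 * i + 3}"
    "ladder_bag (3 * i + 2) = {3 * i + 1, 3 * i + 3, 3 * i + 4}"
    unfolding ladder_bag_def Let_def by simp_all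
qed

lemma nat_mod_3_cases:
  obtains i where "a = 3 * i" | i where "a = 3 * i + 1" | i where "a = 3 * i + (2::nat)"
proof -
  have "\<exists>i. a = 3 * i \<or> a = 3 * i + 1 \<or> a = 3 * i + 2" by presburger
  then show ?thesis using that by blast
qed

text \<open>On a path this is the connectedness condition. Each rail variable lies in at most four
  consecutive bags and each \<open>z\<^sub>i\<close> in one. For \<open>i = 0\<close> truncated
  subtraction yields the correct lower end 0.\<close>

lemma ladder_bag_interval: "\<exists>l h. \<forall>j. a \<in> ladder_bag j \<longleftrightarrow> l \<le> j \<and> j < h"
proof (cases a rule: nat_mod_3_cases)
  case (1 i)
  have "a \<in> ladder_bag j \<longleftrightarrow> 3 * i \<le> j + 2 \<and> j < 3 * i + 2" for j
    unfolding 1 by (rule nat_mod_3_cases[of j]; simp only: ladder_bag_simps insert_iff empty_iff; presburger)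
  then have "\<forall>j. a \<in> ladder_bag j \<longleftrightarrow> 3 * i - 2 \<le> j \<and> j < 3 * i + 2"
    unfolding le_diff_conv by blast
  then show ?thesis by blast
next
  case (2 i)
  have "a \<in> ladder_bag j \<longleftrightarrow> 3 * i \<le> j + 1 \<and> j < 3 * i + 3" for j
    unfolding 2 by (rule nat_mod_3_cases[of j]; simp only: ladder_bag_simps insert_iff empty_iff; presburger)
  then have "\<forall>j. a \<in> ladder_bag j \<longleftrightarrow> 3 * i - 1 \<le> j \<and> j < 3 * i + 3"
    unfolding le_diff_conv by blast
  then show ?thesis by blast
next
  case (3 i)
  have "a \<in> ladder_bag j \<longleftrightarrow> 3 * i \<le> j \<and> j < 3 * i + 1" for j
    unfolding 3 by (rule nat_mod_3_cases[of j]; simp only: ladder_bag_simps insert_iff empty_iff; presburger)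
  then show ?thesis by blast
qed

lemma ladder_treewidth:
  assumes "0 < n"
  shows "treewidth (set (ladder n)) \<le> 2"
proof -
  \<comment> \<open>The path has three nodes per rung; \<open>0 < n\<close> makes it contain the
    root.\<close>
  define T where "T = {u. \<exists>j<3 * n. u = replicate j (0::nat)}"
  let ?bag = "\<lambda>u :: nat list. ladder_bag (length u)"
  have fin: "T = (\<lambda>j. replicate j 0) ` {..<3 * n}" by (auto simp: T_def)
  have tree: "is_tree T"
    unfolding is_tree_def
  proof (intro conjI allI impI)
    show "finite T" by (simp add: fin)
    show "[] \<in> T" using assms by (auto simp: T_def)
    fix u i assume "u @ [i] \<in> T"
    then obtain j where j: "j < 3 * n" "u @ [i] = replicate j 0" by (auto simp: T_def)
    then obtain k where "j = Suc k" by (cases j) auto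
    then show "u \<in> T" using j by (auto simp: T_def replicate_append_same[symmetric])
  qed
  \<comment> \<open>The variables in the three bags of rung \<open>i\<close> all occur in the atoms
    of that rung.\<close>
  have in_adom: "v \<in> adom (set (ladder n))"
    if "i < n" "v \<in> {3 * i, 3 * i + 1, 3 * i + 2, 3 * i + 3, 3 * i + 4}" for v i
  proof -
    have "set (rung i) \<subseteq> set (ladder n)" using that by (auto simp: ladder_def)
    moreover have "v \<in> adom (set (rung i))" using that(2) by (auto simp: adom_def rung_def)
    ultimately show ?thesis by (auto simp: adom_def)
  qed
  have bag: "ladder_bag j \<subseteq> adom (set (ladder n))" if "j < 3 * n" for j
    using in_adom[of "j div 3"] that by (auto simp: ladder_bag_def Let_def split: if_splits)
  have bag': "?bag u \<subseteq> adom (set (ladder n))" if "u \<in> T" for u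
  proof -
    obtain j where "j < 3 * n" "u = replicate j 0" using \<open>u \<in> T\<close> by (auto simp: T_def)
    then show ?thesis using bag[of j] by simp
  qed
  have card: "finite (ladder_bag j) \<and> card (ladder_bag j) \<le> 2 + 1" for j
    by (auto simp: ladder_bag_def Let_def card_insert_if)
  have node: "replicate j 0 \<in> T" if "j < 3 * n" for j using that by (auto simp: T_def)
  have covered: "\<exists>u\<in>T. set (snd F) \<subseteq> ?bag u" if F: "F \<in> set (ladder n)" for F
  proof -
    have "\<exists>j<3 * n. set (snd F) \<subseteq> ladder_bag j"
    proof (cases "F \<in> {(0, [0]), (1, [1])}")
      case True
      then have "set (snd F) \<subseteq> ladder_bag 0" by (auto simp: ladder_bag_def)
      then show ?thesis using assms by (intro exI[of _ 0]) simp
    next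
      case False
      then obtain i where i: "i < n" "F \<in> set (rung i)" using F by (auto simp: ladder_def)
      from i(2) have "set (snd F) \<subseteq> ladder_bag (3 * i) \<or> set (snd F) \<subseteq> ladder_bag (3 * i + 1) \<or>
          set (snd F) \<subseteq> ladder_bag (3 * i + 2)"
        unfolding ladder_bag_simps rung_def by auto
      then consider "set (snd F) \<subseteq> ladder_bag (3 * i)" | "set (snd F) \<subseteq> ladder_bag (3 * i + 1)"
        | "set (snd F) \<subseteq> ladder_bag (3 * i + 2)"
        by blast
      then show ?thesis
      proof cases
        case 1 then show ?thesis using i by (intro exI[of _ "3 * i"]) simp
      next
        case 2 then show ?thesis using i by (intro exI[of _ "3 * i + 1"]) simp
      next
        case 3 then show ?thesis using i by (intro exI[of _ "3 * i + 2"]) simp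
      qed
    qed
    then obtain j where "j < 3 * n" "set (snd F) \<subseteq> ladder_bag j" by blast
    then show ?thesis using node by (intro bexI[of _ "replicate j 0"]) simp_all
  qed
  have "tree_connected {u \<in> T. a \<in> ?bag u}" for a
  proof -
    obtain l h where lh: "\<And>j. a \<in> ladder_bag j \<longleftrightarrow> l \<le> j \<and> j < h"
      using ladder_bag_interval by blast
    have "{u \<in> T. a \<in> ?bag u} =
        {u. \<exists>j. l \<le> j \<and> j < min h (3 * n) \<and> u = replicate j (0::nat)}"
      by (auto simp: T_def lh)
    then show ?thesis by (simp only: tree_connected_interval)
  qed
  then have "tree_decomposition 2 (set (ladder n)) T ?bag"
    unfolding tree_decomposition_def using tree card covered bag' by simp
  then show ?thesis unfolding treewidth_def by (blast intro: Least_le)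
qed

section \<open>Length of the query code\<close>

lemma length_bits: "length (bits n) \<le> n"
proof (induction n rule: bits.induct)
  case (1 n)
  then show ?case by (subst bits.simps) (auto intro: le_trans)
qed

text \<open>A rung has eight variable occurrences, each coded in roughly \<open>3 * n\<close>
  symbols by the crude bound \<open>length_bits\<close>. Any polynomial bound will do.\<close>

lemma length_ladder_code: "length (cq_code (ladder n)) \<le> 24 * n * n + 60 * n + 20"
proof -
  have rung: "length (concat (map ser (map fact_sexp (rung i)))) \<le> 24 * n + 60" if "i < n" for i
    using that length_bits[of "3 * i"] length_bits[of "3 * i + 1"] length_bits[of "3 * i + 2"]
      length_bits[of "3 * i + 3"] length_bits[of "3 * i + 4"] length_bits[of 2] length_bits[of 3]
    by (simp add: rung_def fact_sexp_def)
  have "length (concat (map ser (map fact_sexp (concat (map rung [0..<m]))))) \<le> m * (24 * n + 60)"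
    if "m \<le> n" for m
    using that
  proof (induction m)
    case (Suc m)
    then show ?case using rung[of m] by simp
  qed simp
  from this[of n] show ?thesis
    using length_bits[of 0] length_bits[of 1] by (simp add: cq_code_def ladder_def fact_sexp_def algebra_simps)
qed


section \<open>The instances\<close>

lemma component_adj:
  assumes "x \<in> S" "y \<in> S" "tree_adj x y"
  shows "component S x = component S y"
proof -
  let ?r = "{(x, y). x \<in> S \<and> y \<in> S \<and> tree_adj x y}"
  have "(x, y) \<in> ?r" "(y, x) \<in> ?r" using assms by (auto simp: tree_adj_def)
  then show ?thesis
    unfolding component_def by (auto intro: converse_rtrancl_into_rtrancl)
qed

lemma enc_elem_child:
  assumes "u \<in> fst t" "u @ [b] \<in> fst t" "a \<in> fst (snd t u)" "a \<in> fst (snd t (u @ [b]))"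
  shows "enc_elem t (u @ [b]) a = enc_elem t u a"
proof -
  have "component {v \<in> fst t. a \<in> fst (snd t v)} (u @ [b]) = component {v \<in> fst t. a \<in> fst (snd t v)} u"
    by (rule component_adj) (use assms in \<open>auto simp: tree_adj_def\<close>)
  then show ?thesis by (simp add: enc_elem_def)
qed

text \<open>A decoded element is a connected set of nodes, so a function that is constant along its
  edges is constant on it. This makes maps on decoded elements well defined.\<close>

lemma enc_elem_eq_invariant:
  assumes step: "\<And>v b. v \<in> fst t \<Longrightarrow> v @ [b] \<in> fst t \<Longrightarrow> a \<in> fst (snd t v) \<Longrightarrow>
      a \<in> fst (snd t (v @ [b])) \<Longrightarrow> g (v @ [b]) = g v"
    and eq: "enc_elem t u a = enc_elem t w a"
  shows "g u = g w"
proof -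
  let ?S = "{v \<in> fst t. a \<in> fst (snd t v)}"
  have "u \<in> component ?S u" by (simp add: component_def)
  also have "component ?S u = component ?S w" using eq by (simp add: enc_elem_def)
  finally have "(w, u) \<in> {(x, y). x \<in> ?S \<and> y \<in> ?S \<and> tree_adj x y}\<^sup>*"
    unfolding component_def by simp
  then show ?thesis
  proof (induction rule: rtrancl_induct)
    case (step y z)
    then show ?case using assms(1) by (auto simp: tree_adj_def)
  qed simp
qed

lemma models_hom:
  assumes "\<And>R xs. (R, xs) \<in> I \<Longrightarrow> (R, map f xs) \<in> J" "models I Q"
  shows "models J Q"
proof -
  from assms(2) obtain h where "\<forall>(R, xs)\<in>set Q. (R, map h xs) \<in> I" by (auto simp: models_def)
  then have "\<forall>(R, xs)\<in>set Q. (R, map (f \<circ> h) xs) \<in> J" using assms(1) by fastforce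
  then show ?thesis unfolding models_def by blast
qed

text \<open>
  All instances share one full binary tree. Names 1 and 2 denote the two constants for the
  bits 0 and 1. Every node \<open>v\<close> of odd depth introduces an element, which lives at \<open>v\<close>, at its
  children (carrying the fact that links it to its bit, the last letter of \<open>v\<close>) and at its
  grandchildren (carrying the fact that links it to the element they introduce). Names 3 and 4
  alternate for these elements. An address is read off at the positions 2, 4, \<dots>, 2 n of a leaf;
  the first letter of a leaf decides whether it is marked according to \<open>X\<close> or to \<open>Y\<close>.
\<close>

definition trie :: "nat \<Rightarrow> bool list set" where
  "trie n = {u. length u \<le> 2 * n + 3}"

text \<open>The name of the element inherited from above at depth \<open>l\<close>. At odd depth the
  newly introduced element takes the other name, \<open>slot (Suc l)\<close>.\<close>

definition slot :: "nat \<Rightarrow> nat" where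
  "slot l = 3 + (l div 2) mod 2"

definition address :: "nat \<Rightarrow> bool list \<Rightarrow> bool list" where
  "address n u = map (\<lambda>i. u ! (2 * i + 2)) [0..<n]"

definition trie_names :: "bool list \<Rightarrow> nat set" where
  "trie_names u = (if odd (length u) then {1, 2, 3, 4} else {1, 2, slot (length u)})"

text \<open>A label holds at most one fact, so bits and links alternate between even and odd depths.
  At even depth \<open>l\<close> the element was introduced by the parent, whose last letter has
  index \<open>l - 2\<close>.\<close>

definition trie_fact :: "nat \<Rightarrow> bool list set \<Rightarrow> bool list set \<Rightarrow> bool list \<Rightarrow> nat fact option" where
  "trie_fact n X Y u = (let l = length u in
     if l = 2 * n + 3 then
       if address n u \<in> (if hd u then Y else X) then Some (if hd u then 1 else 0, [slot l]) else None
     else if l < 2 then None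
     else if odd l then Some (2, [slot (Suc l), slot l])
     else Some (3, [slot l, 1 + of_bool (u ! (l - 2))]))"

definition trie_label :: "nat \<Rightarrow> bool list set \<Rightarrow> bool list set \<Rightarrow> bool list \<Rightarrow> label" where
  "trie_label n X Y u = (trie_names u, trie_fact n X Y u)"

definition trie_enc :: "nat \<Rightarrow> bool list set \<Rightarrow> bool list set \<Rightarrow> label ltree" where
  "trie_enc n X Y = (trie n, trie_label n X Y)"

lemma slot_cases: "slot l = 3 \<or> slot l = 4"
  by (auto simp: slot_def)

lemma slot_Suc_even: "even l \<Longrightarrow> slot (Suc l) = slot l"
  by (auto simp: slot_def elim: evenE)

lemma slot_Suc_odd: "odd l \<Longrightarrow> slot (Suc l) = 7 - slot l"
  by (auto simp: slot_def elim!: oddE) presburger+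

lemma trie_names_range: "trie_names u \<subseteq> {1, 2, 3, 4}"
  using slot_cases[of "length u"] by (auto simp: trie_names_def)

lemma trie_fact_names: "trie_fact n X Y u = Some (R, as) \<Longrightarrow> set as \<subseteq> trie_names u"
  using slot_cases[of "length u"] slot_cases[of "Suc (length u)"]
  by (auto simp: trie_fact_def trie_names_def Let_def split: if_splits)

lemma trie_enc_encoding: "is_encoding sig 5 (trie_enc n X Y)"
proof -
  have "is_tree (trie n)"
    unfolding is_tree_def trie_def using finite_lists_length_le[of "UNIV :: bool set"] by simp
  moreover have "trie_label n X Y u \<in> enc_alphabet sig 5" for u
  proof -
    have "trie_names u \<subseteq> enc_dom 5" using trie_names_range[of u] by (auto simp: enc_dom_def)
    moreover have "card (trie_names u) \<le> 5 + 1"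
      using card_mono[OF _ trie_names_range[of u]] by simp
    moreover have "fact_over sig (trie_names u) F" if "trie_fact n X Y u = Some F" for F
    proof -
      have "sig (fst F) = Some (length (snd F))"
        using that by (auto simp: trie_fact_def sig_def Let_def split: if_splits)
      moreover have "set (snd F) \<subseteq> trie_names u"
        using trie_fact_names[of n X Y u "fst F" "snd F"] that by simp
      ultimately show ?thesis by (simp add: fact_over_def)
    qed
    ultimately show ?thesis by (auto simp: trie_label_def enc_alphabet_def)
  qed
  ultimately show ?thesis
    by (simp add: is_encoding_def full_binary_def trie_enc_def trie_def)
qed

text \<open>\<open>Inr v\<close> stands for the element introduced at the odd node \<open>v\<close>,
  and \<open>Inl\<close> for a constant. The inherited element comes from the parent at even depth
  and from the grandparent at odd depth. Near the root, truncated subtraction gives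
  \<open>Inr []\<close>, the element that the root itself holds.\<close>

definition owner :: "nat \<Rightarrow> bool list \<Rightarrow> nat + bool list" where
  "owner a u = (if a \<le> 2 then Inl a
     else if a = slot (length u) then Inr (take (length u - (if even (length u) then 1 else 2)) u)
     else Inr u)"

lemma owner_child:
  assumes "a \<in> trie_names u" "a \<in> trie_names (u @ [b])"
  shows "owner a (u @ [b]) = owner a u"
proof (cases "even (length u)")
  case True
  then show ?thesis
    using assms slot_Suc_even[OF True] slot_cases[of "length u"]
    by (auto simp: owner_def trie_names_def)
next
  case False
  then show ?thesis
    using assms slot_Suc_odd[OF False] slot_cases[of "length u"]
    by (auto simp: owner_def trie_names_def)
qed

text \<open>The decoded instance with explicit names for its elements, so that its facts can be read
  off without connected components.\<close>

definition trie_inst :: "nat \<Rightarrow> bool list set \<Rightarrow> bool list set \<Rightarrow> (nat + bool list) inst" where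
  "trie_inst n X Y = {(R, map (\<lambda>a. owner a u) as) | u R as.
     u \<in> trie n \<and> trie_fact n X Y u = Some (R, as)}"

lemma trie_instI:
  "u \<in> trie n \<Longrightarrow> trie_fact n X Y u = Some (R, as) \<Longrightarrow> xs = map (\<lambda>a. owner a u) as \<Longrightarrow>
    (R, xs) \<in> trie_inst n X Y"
  unfolding trie_inst_def by blast

text \<open>The decoded instance and \<open>trie_inst\<close> are isomorphic, via \<open>owner\<close>.\<close>

lemma models_decode_trie_iff:
  "models (decode (trie_enc n X Y)) Q \<longleftrightarrow> models (trie_inst n X Y) Q"
proof
  let ?t = "trie_enc n X Y"
  \<comment> \<open>An element is sent to its owner as seen from any node that holds it. The choice
    is immaterial because \<open>owner\<close> is constant on elements.\<close>
  define f where "f p = (SOME e. \<exists>u a. u \<in> trie n \<and> a \<in> trie_names u \<and>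
    p = enc_elem ?t u a \<and> e = owner a u)" for p
  have f: "f (enc_elem ?t u a) = owner a u" if ua: "u \<in> trie n" "a \<in> trie_names u" for u a
  proof -
    have "\<exists>w b. w \<in> trie n \<and> b \<in> trie_names w \<and>
        enc_elem ?t u a = enc_elem ?t w b \<and> f (enc_elem ?t u a) = owner b w"
      unfolding f_def by (rule someI[of _ "owner a u"]) (use ua in blast)
    then obtain w b where w: "w \<in> trie n" "b \<in> trie_names w"
      "enc_elem ?t u a = enc_elem ?t w b" "f (enc_elem ?t u a) = owner b w"
      by blast
    then have b: "b = a" by (simp add: enc_elem_def)
    have "owner a u = owner a w"
      by (rule enc_elem_eq_invariant[of ?t a "owner a"])
         (use w b in \<open>auto simp: trie_enc_def trie_label_def owner_child\<close>)
    then show ?thesis using w b by simp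
  qed
  assume "models (decode ?t) Q"
  then show "models (trie_inst n X Y) Q"
  proof (rule models_hom[of _ f, rotated])
    fix R xs assume "(R, xs) \<in> decode ?t"
    then obtain u as where u: "u \<in> trie n" "trie_fact n X Y u = Some (R, as)"
      "xs = map (enc_elem ?t u) as"
      by (auto simp: decode_def trie_enc_def trie_label_def)
    have "map f xs = map (\<lambda>a. owner a u) as"
      using u f trie_fact_names[OF u(2)] by auto
    with u(1,2) show "(R, map f xs) \<in> trie_inst n X Y" unfolding trie_inst_def by blast
  qed
next
  let ?t = "trie_enc n X Y"
  \<comment> \<open>The inverse map looks each element up at the node introducing it, and the
    constants at the root.\<close>
  define f where "f e = (case e of Inl a \<Rightarrow> enc_elem ?t [] a
    | Inr v \<Rightarrow> enc_elem ?t v (slot (Suc (length v))))" for e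
  have pre: "u \<in> trie n" if "u @ [b] \<in> trie n" for u b using that by (simp add: trie_def)
  have child: "enc_elem ?t (u @ [b]) a = enc_elem ?t u a"
    if "u @ [b] \<in> trie n" "a \<in> trie_names u" "a \<in> trie_names (u @ [b])" for u b a
    by (rule enc_elem_child) (use that pre in \<open>auto simp: trie_enc_def trie_label_def\<close>)
  have f: "f (owner a u) = enc_elem ?t u a" if "u \<in> trie n" "a \<in> trie_names u" for u a
    using that
  proof (induction u rule: rev_induct)
    case Nil
    then show ?case by (auto simp: owner_def trie_names_def slot_def f_def)
  next
    case (snoc b u)
    show ?case
    proof (cases "a \<in> trie_names u")
      case True
      then show ?thesis
        using snoc child[OF snoc.prems(1) True] owner_child[OF True] pre by simp
    next
      case False
      \<comment> \<open>A name missing at the parent is the one introduced at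
        \<open>u @ [b]\<close>, where \<open>f\<close> looks it up by definition.\<close>
      then have "a > 2" "odd (length (u @ [b]))" "a \<noteq> slot (length u)"
        using snoc.prems(2) slot_cases[of "length (u @ [b])"]
        by (auto simp: trie_names_def split: if_splits)
      moreover from this have "a = slot (Suc (length (u @ [b])))" "a \<noteq> slot (length (u @ [b]))"
        using snoc.prems(2) slot_Suc_odd[of "length (u @ [b])"] slot_Suc_even[of "length u"]
          slot_cases[of "length u"]
        by (auto simp: trie_names_def)
      ultimately show ?thesis by (simp add: owner_def f_def)
    qed
  qed
  assume "models (trie_inst n X Y) Q"
  then show "models (decode ?t) Q"
  proof (rule models_hom[of _ f, rotated])
    fix R xs assume "(R, xs) \<in> trie_inst n X Y"
    then obtain u as where u: "u \<in> trie n" "trie_fact n X Y u = Some (R, as)"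
      "xs = map (\<lambda>a. owner a u) as"
      by (auto simp: trie_inst_def)
    have "map f xs = map (enc_elem ?t u) as"
      using u f trie_fact_names[OF u(2)] by auto
    moreover have "u \<in> fst ?t" "snd (snd ?t u) = Some (R, as)"
      using u by (simp_all add: trie_enc_def trie_label_def)
    ultimately show "(R, map f xs) \<in> decode ?t" unfolding decode_def by blast
  qed
qed

section \<open>The facts of the instance, relation by relation\<close>

lemma trie_inst_mark:
  "(0, [e]) \<in> trie_inst n X Y \<longleftrightarrow> (\<exists>u. length u = 2 * n + 3 \<and> \<not> hd u \<and> address n u \<in> X \<and>
     e = Inr (take (2 * n + 1) u))" (is "?A \<longleftrightarrow> ?B")
  "(1, [e]) \<in> trie_inst n X Y \<longleftrightarrow> (\<exists>u. length u = 2 * n + 3 \<and> hd u \<and> address n u \<in> Y \<and>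
     e = Inr (take (2 * n + 1) u))" (is "?C \<longleftrightarrow> ?D")
proof -
  have own: "owner (slot (2 * n + 3)) u = Inr (take (2 * n + 1) u)" if "length u = 2 * n + 3" for u
    using that slot_cases[of "2 * n + 3"] by (auto simp: owner_def)
  show "?A \<longleftrightarrow> ?B"
  proof
    assume ?A
    then show ?B
      by (auto simp: trie_inst_def trie_fact_def Let_def own split: if_splits)
  next
    assume ?B
    then obtain u where u: "length u = 2 * n + 3" "\<not> hd u" "address n u \<in> X"
      "e = Inr (take (2 * n + 1) u)" by blast
    then have "u \<in> trie n" "trie_fact n X Y u = Some (0, [slot (2 * n + 3)])"
      by (simp_all add: trie_def trie_fact_def)
    then show ?A by (rule trie_instI) (use own u in simp)
  qed
  show "?C \<longleftrightarrow> ?D"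
  proof
    assume ?C
    then show ?D
      by (auto simp: trie_inst_def trie_fact_def Let_def own split: if_splits)
  next
    assume ?D
    then obtain u where u: "length u = 2 * n + 3" "hd u" "address n u \<in> Y"
      "e = Inr (take (2 * n + 1) u)" by blast
    then have "u \<in> trie n" "trie_fact n X Y u = Some (1, [slot (2 * n + 3)])"
      by (simp_all add: trie_def trie_fact_def)
    then show ?C by (rule trie_instI) (use own u in simp)
  qed
qed

lemma trie_inst_edge:
  "(2, [e, e']) \<in> trie_inst n X Y \<longleftrightarrow> (\<exists>v. odd (length v) \<and> 3 \<le> length v \<and> length v \<le> 2 * n + 1 \<and>
     e = Inr v \<and> e' = Inr (take (length v - 2) v))" (is "?A \<longleftrightarrow> ?B")
proof -
  have own: "owner (slot (Suc (length v))) v = Inr v"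
    "owner (slot (length v)) v = Inr (take (length v - 2) v)" if "odd (length v)" for v
    using that slot_Suc_odd[OF that] slot_cases[of "length v"] by (auto simp: owner_def)
  show ?thesis
  proof
    assume ?A
    then obtain v where v: "length v \<le> 2 * n + 3" "length v \<noteq> 2 * n + 3" "2 \<le> length v"
      "odd (length v)" "e = owner (slot (Suc (length v))) v" "e' = owner (slot (length v)) v"
      by (auto simp: trie_inst_def trie_fact_def trie_def Let_def split: if_splits)
    have "3 \<le> length v \<and> length v \<le> 2 * n + 1" using v(1-4) by presburger
    then show ?B using v own[OF v(4)] by auto
  next
    assume ?B
    then obtain v where v: "odd (length v)" "3 \<le> length v" "length v \<le> 2 * n + 1"
     "e = Inr v" "e' = Inr (take (length v - 2) v)" by blast
    then have "v \<in> trie n" "trie_fact n X Y v = Some (2, [slot (Suc (length v)), slot (length v)])"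
      by (simp_all add: trie_def trie_fact_def Let_def)
    then show ?A by (rule trie_instI) (use v own[OF v(1)] in simp)
  qed
qed

lemma last_take_nth: "k < length u \<Longrightarrow> last (take (Suc k) u) = u ! k"
  by (simp add: take_Suc_conv_app_nth)

lemma trie_inst_bit:
  "(3, [e, e']) \<in> trie_inst n X Y \<longleftrightarrow> (\<exists>v. odd (length v) \<and> length v \<le> 2 * n + 1 \<and>
     e = Inr v \<and> e' = Inl (1 + of_bool (last v)))" (is "?A \<longleftrightarrow> ?B")
proof -
  have own: "owner (slot (length u)) u = Inr (take (length u - 1) u)" if "even (length u)" for u
    using that slot_cases[of "length u"] by (auto simp: owner_def)
  have bit: "owner (Suc (of_bool c)) u = Inl (Suc (of_bool c))" for c u by (simp add: owner_def)
  show ?thesis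
  proof
    assume ?A
    then obtain u where u: "length u \<le> 2 * n + 3" "2 \<le> length u" "even (length u)"
      "e = owner (slot (length u)) u" "e' = Inl (1 + of_bool (u ! (length u - 2)))"
      by (auto simp: trie_inst_def trie_fact_def trie_def Let_def bit split: if_splits)
    define v where "v = take (length u - 1) u"
    have "last v = u ! (length u - 2)"
      using u(2) last_take_nth[of "length u - 2" u] by (simp add: v_def Suc_diff_le[symmetric])
    moreover have "odd (length u - 1) \<and> length u - 1 \<le> 2 * n + 1" using u(1-3) by presburger
    then have "odd (length v) \<and> length v \<le> 2 * n + 1" by (simp add: v_def)
    ultimately show ?B using u own[OF u(3)] v_def by auto
  next
    assume ?B
    then obtain v where v: "odd (length v)" "length v \<le> 2 * n + 1"
      "e = Inr v" "e' = Inl (1 + of_bool (last v))" by blast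
    \<comment> \<open>Both children of \<open>v\<close> carry this fact; the left one serves as
      witness.\<close>
    let ?u = "v @ [False]"
    have "v \<noteq> []" using v(1) by auto
    then have "(v @ [False]) ! (length v - 1) = last v" by (simp add: nth_append last_conv_nth)
    then have "?u \<in> trie n" "trie_fact n X Y ?u = Some (3, [slot (length ?u), 1 + of_bool (last v)])"
      using v by (auto simp: trie_def trie_fact_def Let_def)
    then show ?A by (rule trie_instI) (use v own[of ?u] bit in simp)
  qed
qed

text \<open>Relation 2 is functional: each element has at most one successor, so a rail is
  determined by its start.\<close>

lemma trie_path_up:
  assumes "length u = 2 * n + 3" "x 0 = Inr (take (2 * n + 1) u)"
    and "\<And>i. i < n \<Longrightarrow> (2, [x i, x (Suc i)]) \<in> trie_inst n X Y"
  shows "i \<le> n \<Longrightarrow> x i = Inr (take (2 * (n - i) + 1) u)"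
proof (induction i)
  case (Suc i)
  then have "(2, [Inr (take (2 * (n - i) + 1) u), x (Suc i)]) \<in> trie_inst n X Y"
    using assms(3)[of i] by simp
  then show ?case
    using assms(1) Suc.prems by (auto simp: trie_inst_edge min_def Suc_diff_Suc[symmetric])
qed (use assms in simp)

text \<open>Climbing from a leaf meets the address from its last bit to its first, hence the index
  \<open>2 * (n - i)\<close> at step \<open>i\<close>.\<close>

lemma address_determines_bits:
  "address n u = address n w \<longleftrightarrow> (\<forall>i<n. u ! (2 * (n - i)) = w ! (2 * (n - i)))"
proof
  assume *: "address n u = address n w"
  show "\<forall>i<n. u ! (2 * (n - i)) = w ! (2 * (n - i))"
  proof (intro allI impI)
    fix i assume "i < n"
    then have "u ! (2 * (n - Suc i) + 2) = w ! (2 * (n - Suc i) + 2)"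
      using arg_cong[OF *, of "\<lambda>l. l ! (n - Suc i)"] by (simp add: address_def)
    moreover have "2 * (n - Suc i) + 2 = 2 * (n - i)" using \<open>i < n\<close> by simp
    ultimately show "u ! (2 * (n - i)) = w ! (2 * (n - i))" by simp
  qed
next
  assume *: "\<forall>i<n. u ! (2 * (n - i)) = w ! (2 * (n - i))"
  have "u ! (2 * j + 2) = w ! (2 * j + 2)" if "j < n" for j
  proof -
    have "2 * (n - (n - Suc j)) = 2 * j + 2" using that by simp
    then show ?thesis using *[rule_format, of "n - Suc j"] that by simp
  qed
  then show "address n u = address n w" by (simp add: address_def)
qed

lemma leaf_with_address:
  assumes "length w = n"
  obtains u where "length u = 2 * n + 3" "hd u = c" "address n u = w"
proof -
  \<comment> \<open>Bit \<open>j\<close> is placed at index \<open>2 * j + 2\<close>; the remaining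
    positions after the first are padded with \<open>False\<close>.\<close>
  define u where "u = map (\<lambda>k. if k = 0 then c else even k \<and> k \<le> 2 * n \<and> w ! (k div 2 - 1))
    [0..<2 * n + 3]"
  have "address n u = w"
    by (rule nth_equalityI) (use assms in \<open>auto simp: address_def u_def simp del: upt_Suc\<close>)
  moreover have "hd u = c" by (simp add: u_def hd_map del: upt_Suc)
  ultimately show ?thesis using that[of u] by (simp add: u_def)
qed

text \<open>The marks place one rail in each half of the tree, both climb towards the root, and the
  rungs say that the two addresses coincide.\<close>

lemma models_trie_ladder_iff:
  "models (decode (trie_enc n X Y)) (ladder n) \<longleftrightarrow> (\<exists>w. length w = n \<and> w \<in> X \<and> w \<in> Y)"
  unfolding models_decode_trie_iff
proof
  assume "models (trie_inst n X Y) (ladder n)"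
  then obtain x y z where xyz: "(0, [x 0]) \<in> trie_inst n X Y" "(1, [y 0]) \<in> trie_inst n X Y"
    "\<And>i. i < n \<Longrightarrow> (3, [x i, z i]) \<in> trie_inst n X Y"
    "\<And>i. i < n \<Longrightarrow> (3, [y i, z i]) \<in> trie_inst n X Y"
    "\<And>i. i < n \<Longrightarrow> (2, [x i, x (Suc i)]) \<in> trie_inst n X Y"
    "\<And>i. i < n \<Longrightarrow> (2, [y i, y (Suc i)]) \<in> trie_inst n X Y"
    unfolding models_ladder_iff by blast
  obtain u where u: "length u = 2 * n + 3" "address n u \<in> X" "x 0 = Inr (take (2 * n + 1) u)"
    using xyz(1) unfolding trie_inst_mark by blast
  obtain w where w: "length w = 2 * n + 3" "address n w \<in> Y" "y 0 = Inr (take (2 * n + 1) w)"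
    using xyz(2) unfolding trie_inst_mark by blast
  have bitD: "e = Inl (1 + of_bool (v ! k))"
    if "(3, [Inr (take (k + 1) v), e]) \<in> trie_inst n X Y" "k < length v" for k v e
    using that(1) last_take_nth[OF that(2)] unfolding trie_inst_bit by fastforce
  have "u ! (2 * (n - i)) = w ! (2 * (n - i))" if "i < n" for i
  proof -
    have "x i = Inr (take (2 * (n - i) + 1) u)" "y i = Inr (take (2 * (n - i) + 1) w)"
      using trie_path_up[OF u(1,3) xyz(5)] trie_path_up[OF w(1,3) xyz(6)] that by simp_all
    then have "z i = Inl (1 + of_bool (u ! (2 * (n - i))))"
      "z i = Inl (1 + of_bool (w ! (2 * (n - i))))"
      using bitD[of "2 * (n - i)" u "z i"] bitD[of "2 * (n - i)" w "z i"] xyz(3,4)[OF that] u(1) w(1)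
      by simp_all
    then show ?thesis by (simp add: of_bool_eq_iff)
  qed
  then have "address n u = address n w" by (simp add: address_determines_bits)
  then show "\<exists>w. length w = n \<and> w \<in> X \<and> w \<in> Y"
    using u(2) w(2) by (intro exI[of _ "address n u"]) (simp, simp add: address_def)
next
  assume "\<exists>w. length w = n \<and> w \<in> X \<and> w \<in> Y"
  then obtain a where a: "length a = n" "a \<in> X" "a \<in> Y" by blast
  obtain u where u: "length u = 2 * n + 3" "hd u = False" "address n u = a"
    using leaf_with_address[OF a(1)] .
  obtain w where w: "length w = 2 * n + 3" "hd w = True" "address n w = a"
    using leaf_with_address[OF a(1)] .
  have eq: "u ! (2 * (n - i)) = w ! (2 * (n - i))" if "i < n" for i
    using u(3) w(3) that address_determines_bits[of n u w] by simp
  \<comment> \<open>The rails are the elements on the paths above the two leaves. By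
    \<open>eq\<close> the bits read along \<open>u\<close> also serve for \<open>w\<close>.\<close>
  define path where "path v i = (Inr (take (2 * (n - i) + 1) v) :: nat + bool list)" for v i
  define z where "z i = (Inl (1 + of_bool (u ! (2 * (n - i)))) :: nat + bool list)" for i
  have edge: "(2, [path v i, path v (Suc i)]) \<in> trie_inst n X Y"
    if "length v = 2 * n + 3" "i < n" for v i
  proof -
    have m: "n - i = Suc (n - Suc i)" "n - Suc i < n" using that(2) by arith+
    show ?thesis
      unfolding trie_inst_edge path_def m(1) using m(2) that(1)
      by (intro exI[of _ "take (2 * Suc (n - Suc i) + 1) v"]) (simp add: min_def)
  qed
  have bit: "(3, [path v i, z i]) \<in> trie_inst n X Y"
    if "length v = 2 * n + 3" "i < n" "v ! (2 * (n - i)) = u ! (2 * (n - i))" for v i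
    using that by (simp add: trie_inst_bit path_def z_def last_take_nth min_def)
  have "(0, [path u 0]) \<in> trie_inst n X Y" "(1, [path w 0]) \<in> trie_inst n X Y"
    unfolding trie_inst_mark path_def using a u w by auto
  then show "models (trie_inst n X Y) (ladder n)"
    unfolding models_ladder_iff using edge[OF u(1)] edge[OF w(1)] bit[OF u(1)] bit[OF w(1)] eq
    by - (rule exI[of _ "path u"], rule exI[of _ "path w"], rule exI[of _ z], simp)
qed


section \<open>The lower bound\<close>

text \<open>A leaf consults only the set selected by its first letter, and all other labels ignore
  both sets.\<close>

lemma trie_label_hybrid:
  "trie_label n X Y' =
    (\<lambda>u. if u \<in> {u. u \<noteq> [] \<and> \<not> hd u} then trie_label n X Y u else trie_label n X' Y' u)"
  by (rule ext) (auto simp: trie_label_def trie_fact_def Let_def)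

text \<open>A single edge crosses the cut, so agreement has to be checked at its two ends
  only.\<close>

lemma left_subtree_border:
  assumes "w \<in> {u. u \<noteq> [] \<and> \<not> hd u}" "w' \<notin> {u. u \<noteq> [] \<and> \<not> hd u}" "tree_adj w w'"
  shows "w = [False] \<and> w' = []"
  using assms unfolding tree_adj_def by (cases w'; cases w) auto

lemma accepts_iff_accepts_from: "accepts A t \<longleftrightarrow> accepts_from A t (init A) []"
  by (simp add: accepts_def accepts_from_def)

lemma many_states_for_ladder:
  assumes aut: "is_automaton \<Gamma> A" and tests: "tests_query sig 5 A (ladder n)"
  shows "2 ^ n \<le> 2 * card (states A)"
proof -
  define W where "W = {w :: bool list. length w = n}"
  define t where "t X = trie_enc n X (- X)" for X
  define \<phi> where "\<phi> X = ({q \<in> states A. accepts_from A (t X) q []},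
    {q \<in> states A. accepts_from A (t X) q [False]})" for X
  have accepts: "accepts A (trie_enc n X Y) \<longleftrightarrow> (\<exists>w. length w = n \<and> w \<in> X \<and> w \<in> Y)" for X Y
    using tests trie_enc_encoding[of n X Y]
    unfolding tests_query_def models_trie_ladder_iff[symmetric] by blast
  have sub: "X \<subseteq> Y" if X: "X \<subseteq> W" and eq: "\<phi> X = \<phi> Y" for X Y
  proof (rule ccontr)
    assume "\<not> X \<subseteq> Y"
    \<comment> \<open>A word in \<open>X\<close> but not in \<open>Y\<close> is a common address of
      \<open>X\<close> and \<open>- Y\<close>.\<close>
    then have "accepts A (trie_enc n X (- Y))"
      using X by (auto simp: accepts W_def)
    then have hybrid: "accepts_from A (trie n, \<lambda>u. if u \<in> {u. u \<noteq> [] \<and> \<not> hd u}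
        then trie_label n X (- X) u else trie_label n Y (- Y) u) (init A) []"
      by (simp only: accepts_iff_accepts_from trie_enc_def trie_label_hybrid[of n X "- Y" "- X" Y])
    have agree: "(accepts_from A (trie n, trie_label n X (- X)) q w \<longleftrightarrow>
          accepts_from A (trie n, trie_label n Y (- Y)) q w) \<and>
        (accepts_from A (trie n, trie_label n X (- X)) q w' \<longleftrightarrow>
          accepts_from A (trie n, trie_label n Y (- Y)) q w')"
      if q: "q \<in> states A" and w: "w \<in> {u. u \<noteq> [] \<and> \<not> hd u}" "w' \<notin> {u. u \<noteq> [] \<and> \<not> hd u}"
        "tree_adj w w'" for q w w'
    proof -
      have "accepts_from A (t X) q v \<longleftrightarrow> accepts_from A (t Y) q v"
        if "v = [] \<or> v = [False]" for v
        using eq q that unfolding \<phi>_def by blast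
      then show ?thesis using left_subtree_border[OF w] by (simp add: t_def trie_enc_def)
    qed
    from accepts_from_hybrid[OF hybrid agree]
    have "accepts_from A (trie n, trie_label n Y (- Y)) (init A) []" by simp
    then have "accepts A (trie_enc n Y (- Y))"
      by (simp add: accepts_iff_accepts_from trie_enc_def)
    \<comment> \<open>\<open>Y\<close> and its complement are disjoint, so the tree for them must be
      rejected.\<close>
    then show False by (simp add: accepts)
  qed
  then have "inj_on \<phi> (Pow W)" by (intro inj_onI) (metis PowD subset_antisym)
  moreover have "\<phi> ` Pow W \<subseteq> Pow (states A) \<times> Pow (states A)" by (auto simp: \<phi>_def)
  moreover have fin: "finite (states A)" using aut by (simp add: is_automaton_def)
  then have "finite (Pow (states A) \<times> Pow (states A))" by simp
  ultimately have "card (Pow W) \<le> card (Pow (states A) \<times> Pow (states A))"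
    by (rule card_inj_on_le)
  moreover have "finite W" "card W = 2 ^ n"
    using card_lists_length_eq[of "UNIV :: bool set" n] finite_lists_length_eq[of "UNIV :: bool set" n]
    by (simp_all add: W_def)
  \<comment> \<open>There are \<open>2 ^ (2 ^ n)\<close> sets of addresses, and a pair of state sets
    can take \<open>2 ^ (2 * card (states A))\<close> values.\<close>
  ultimately have "(2::nat) ^ (2 ^ n) \<le> 2 ^ (2 * card (states A))"
    using fin by (simp add: card_Pow card_cartesian_product mult_2 power_add)
  then show ?thesis by (rule power_le_imp_le_exp[rotated]) simp
qed

section \<open>From the number of states to the output length\<close>

lemma card_states_le_code_length:
  assumes "is_automaton_code \<Gamma> A v"
  shows "card (states A) \<le> length v"
proof -
  obtain qs E where qs: "distinct qs" "set qs = states A" "v = ser (Lst (Lst (map Num qs) # E))"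
    using assms unfolding is_automaton_code_def by blast
  \<comment> \<open>The code of each state contributes at least its end symbol.\<close>
  have "length qs \<le> length (concat (map ser (map Num qs)))"
    by (induction qs) auto
  also have "\<dots> \<le> length v" by (simp add: qs(3))
  finally show ?thesis using qs(1,2) distinct_card by fastforce
qed

lemma poly_nat_mono: "x \<le> y \<Longrightarrow> poly p x \<le> poly p (y :: nat)"
  by (simp add: poly_altdef sum_mono power_mono)

lemma poly_nat_less_exp: "\<exists>n>0. 2 * poly p n < (2::nat) ^ n"
proof -
  define d where "d = degree p"
  define C where "C = (\<Sum>i\<le>d. coeff p i)"
  define j where "j = 2 * d + 2 * C"
  \<comment> \<open>With \<open>n\<close> a power of two, \<open>n ^ d\<close> is one too, and only
    exponents need comparing. The choice of \<open>j\<close> bounds the exponent by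
    \<open>(j + 1) * (j + 1)\<close>, which is at most \<open>2 ^ j * 2 ^ j = n\<close>.\<close>
  define n :: nat where "n = 2 ^ (2 * j)"
  have "poly p n \<le> (\<Sum>i\<le>d. coeff p i * n ^ d)"
    unfolding poly_altdef d_def by (intro sum_mono mult_left_mono power_increasing) (simp_all add: n_def)
  also have "\<dots> = C * n ^ d" by (simp add: C_def sum_distrib_right)
  finally have "2 * poly p n \<le> 2 * C * n ^ d" by simp
  also have "\<dots> < 2 ^ (2 * C) * n ^ d"
    using less_exp[of "2 * C"] by (simp add: n_def)
  also have "\<dots> = 2 ^ (2 * C + 2 * j * d)" by (simp add: n_def power_add power_mult)
  also have "\<dots> \<le> 2 ^ n"
  proof (rule power_increasing)
    have "2 * C + 2 * j * d \<le> (j + 1) * (j + 1)" by (simp add: j_def algebra_simps)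
    also have "\<dots> \<le> 2 ^ j * 2 ^ j"
      using less_exp[of j] by (intro mult_mono) (simp_all add: Suc_le_eq)
    also have "\<dots> = n" by (simp add: n_def power_add mult_2)
    finally show "2 * C + 2 * j * d \<le> n" .
  qed simp
  finally show ?thesis by (intro exI[of _ n]) (simp add: n_def)
qed

theorem theorem5:
  shows "\<exists>\<sigma>. is_signature \<sigma> \<and> signature_arity \<sigma> = 2 \<and>
    \<not> (\<exists>M (p :: nat poly) (q :: nat poly). is_tm M \<and>
        (\<forall>Q. cq_over \<sigma> Q \<and> treewidth (set Q) \<le> 2 \<longrightarrow>
          (\<exists>v A. tm_computes M (cq_code Q) (2 ^ poly p (length (cq_code Q))) v \<and>
             length v \<le> poly q (length (cq_code Q)) \<and>
             is_automaton (enc_alphabet \<sigma> 5) A \<and>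
             is_automaton_code (enc_alphabet \<sigma> 5) A v \<and>
             tests_query \<sigma> 5 A Q)))"
proof (intro exI[of _ sig] conjI sig_signature sig_arity notI)
  assume "\<exists>M (p :: nat poly) (q :: nat poly). is_tm M \<and>
        (\<forall>Q. cq_over sig Q \<and> treewidth (set Q) \<le> 2 \<longrightarrow>
          (\<exists>v A. tm_computes M (cq_code Q) (2 ^ poly p (length (cq_code Q))) v \<and>
             length v \<le> poly q (length (cq_code Q)) \<and>
             is_automaton (enc_alphabet sig 5) A \<and>
             is_automaton_code (enc_alphabet sig 5) A v \<and>
             tests_query sig 5 A Q))"
  then obtain q :: "nat poly" where q: "\<And>Q. cq_over sig Q \<Longrightarrow> treewidth (set Q) \<le> 2 \<Longrightarrow>
      \<exists>v A. length v \<le> poly q (length (cq_code Q)) \<and> is_automaton (enc_alphabet sig 5) A \<and>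
        is_automaton_code (enc_alphabet sig 5) A v \<and> tests_query sig 5 A Q"
    by blast
  \<comment> \<open>The inner polynomial is the bound on the code length, its coefficients in order
    of increasing degree.\<close>
  obtain n where n: "0 < n" "2 * poly (pcompose q [:20, 60, 24:]) n < 2 ^ n"
    using poly_nat_less_exp by blast
  obtain v A where A: "length v \<le> poly q (length (cq_code (ladder n)))"
    "is_automaton (enc_alphabet sig 5) A" "is_automaton_code (enc_alphabet sig 5) A v"
    "tests_query sig 5 A (ladder n)"
    using q[OF ladder_cq_over ladder_treewidth[OF n(1)]] by blast
  have "2 ^ n \<le> 2 * card (states A)" using A(2,4) by (rule many_states_for_ladder)
  also have "\<dots> \<le> 2 * poly q (length (cq_code (ladder n)))"
    using card_states_le_code_length[OF A(3)] A(1) by simp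
  also have "\<dots> \<le> 2 * poly (pcompose q [:20, 60, 24:]) n"
    using poly_nat_mono[OF length_ladder_code[of n], of q]
    by (simp add: poly_pcompose algebra_simps)
  finally show False using n(2) by simp
qed

end
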